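(* Let $m\ge2$. The map $\Phi_x(u):=u+\frac{x}{1-u}$ is invertible on the set of formal power series in $x$ with zero constant term. Its inverse is $$\Psi_x(v):=\frac{1+v-\sqrt{(1-v)^2+4x}}{2}$$ (square root with constant term $1$, so that $\Psi_x(v)$ has zero constant term), and $\Phi_x(\Psi_x(v))=v$. Consequently, with $U(x):=G_{m-1}(x)$, $$U(x)=G_{m-1}(x)=\Psi_x^{\,m-1}\bigl(G(x)\bigr),\qquad G(x)=\frac{1-\sqrt{1-4mx}}{2},$$ where $\Psi_x^{\,m-1}$ is the $(m-1)$-fold iterate. Moreover, the tail sums $H_k(x):=\sum_{j=k}^{m-1}G_j(x)$ are recovered from $U$ by $$H_{m-1}=U,\qquad H_k=\Phi_x(H_{k+1})\quad(k=m-2,\dots,0),$$ and the components by $G_k=H_k-H_{k+1}$ for $k=0,\dots,m-2$ and $G_{m-1}=H_{m-1}$.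
   Context: For an integer $m\ge2$ let $V_m=\{v_0<v_1<\cdots<v_{m-1}\}$ ($v_0=0$, $v_{m-1}=1$) be an $m$-element chain with Gödel implication $v_p\Rightarrow_G v_q=v_{m-1}$ if $p\le q$ and $v_p\Rightarrow_G v_q=v_q$ if $p>q$. For $n\ge1$, consider the $C_{n-1}$ full bracketings of $p_1\Rightarrow_G\cdots\Rightarrow_G p_n$ in $n$ distinct variables (full binary trees with $n$ ordered leaves), $C_k$ being the Catalan numbers. Let $g_n^{(j)}$ be the number of pairs (bracketing, valuation $\{p_1,\dots,p_n\}\to V_m$) for which the bracketed formula evaluates to $v_j$, and $g_n=\sum_{j=0}^{m-1}g_n^{(j)}=m^nC_{n-1}$. Put $G_j(x)=\sum_{n\ge1}g_n^{(j)}x^n$ and $G(x)=\sum_{n\ge1}g_nx^n=\sum_{j=0}^{m-1}G_j(x)$ (formal power series). *)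

theory Defs
  imports Complex_Main "HOL-Library.FuncSet" "HOL-Computational_Algebra.Formal_Power_Series"
begin

datatype formula = Var nat | Imp formula formula

primrec leaves :: "formula \<Rightarrow> nat list" where
  "leaves (Var i) = [i]"
| "leaves (Imp a b) = leaves a @ leaves b"

text \<open>The full bracketings of \<open>p\<^sub>1 \<Rightarrow> \<dots> \<Rightarrow> p\<^sub>n\<close>: the binary trees whose leaves, read from
  left to right, are the variables \<open>1, \<dots>, n\<close>.\<close>

definition bracketings :: "nat \<Rightarrow> formula set" where
  "bracketings n = {\<phi>. leaves \<phi> = [1..<Suc n]}"

text \<open>The truth value \<open>1\<close> is the top element of the chain under consideration.\<close>

definition goedel_imp :: "'a::{linorder,zero,one} \<Rightarrow> 'a \<Rightarrow> 'a" where
  "goedel_imp a b = (if a \<le> b then 1 else b)"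

primrec eval_formula :: "(nat \<Rightarrow> 'a::{linorder,zero,one}) \<Rightarrow> formula \<Rightarrow> 'a" where
  "eval_formula \<rho> (Var i) = \<rho> i"
| "eval_formula \<rho> (Imp a b) = goedel_imp (eval_formula \<rho> a) (eval_formula \<rho> b)"

text \<open>An \<open>m\<close>-element chain \<open>v 0 < \<dots> < v (m - 1)\<close> with least element \<open>0\<close> and greatest
  element \<open>1\<close>; the values of \<open>v\<close> at arguments \<open>\<ge> m\<close> are irrelevant.\<close>

definition is_chain :: "nat \<Rightarrow> (nat \<Rightarrow> 'a::{linorder,zero,one}) \<Rightarrow> bool" where
  "is_chain m v \<longleftrightarrow> strict_mono_on {..<m} v \<and> v 0 = 0 \<and> v (m - 1) = 1"

definition valuations :: "nat \<Rightarrow> (nat \<Rightarrow> 'a) \<Rightarrow> nat \<Rightarrow> (nat \<Rightarrow> 'a) set" where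
  "valuations m v n = {1..n} \<rightarrow>\<^sub>E v ` {..<m}"

definition count_value :: "nat \<Rightarrow> (nat \<Rightarrow> 'a::{linorder,zero,one}) \<Rightarrow> nat \<Rightarrow> nat \<Rightarrow> nat" where
  "count_value m v j n =
     card {(\<phi>, \<rho>). \<phi> \<in> bracketings n \<and> \<rho> \<in> valuations m v n \<and> eval_formula \<rho> \<phi> = v j}"

definition count_total :: "nat \<Rightarrow> (nat \<Rightarrow> 'a::{linorder,zero,one}) \<Rightarrow> nat \<Rightarrow> nat" where
  "count_total m v n = (\<Sum>j<m. count_value m v j n)"

definition value_fps :: "nat \<Rightarrow> (nat \<Rightarrow> 'a::{linorder,zero,one}) \<Rightarrow> nat \<Rightarrow> 'b::field_char_0 fps" where
  "value_fps m v j = Abs_fps (\<lambda>n. if n \<ge> 1 then of_nat (count_value m v j n) else 0)"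

definition total_fps :: "nat \<Rightarrow> (nat \<Rightarrow> 'a::{linorder,zero,one}) \<Rightarrow> 'b::field_char_0 fps" where
  "total_fps m v = Abs_fps (\<lambda>n. if n \<ge> 1 then of_nat (count_total m v n) else 0)"

lemma total_fps_eq_sum: "total_fps m v = (\<Sum>j<m. value_fps m v j)"
  by (rule fps_ext) (simp add: total_fps_def value_fps_def count_total_def fps_sum_nth)

definition tail_fps :: "nat \<Rightarrow> (nat \<Rightarrow> 'a::{linorder,zero,one}) \<Rightarrow> nat \<Rightarrow> 'b::field_char_0 fps" where
  "tail_fps m v k = (\<Sum>j=k..m - 1. value_fps m v j)"

definition fps_zero_const :: "'b::field_char_0 fps set" where
  "fps_zero_const = {u. fps_nth u 0 = 0}"

text \<open>For a series with constant term \<open>1\<close>, this is the square root with constant term \<open>1\<close>: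
  the first argument of \<^const>\<open>fps_radical\<close> prescribes the root of the constant term.\<close>

definition fps_sqrt :: "'b::field_char_0 fps \<Rightarrow> 'b fps" where
  "fps_sqrt a = fps_radical (\<lambda>_ _. 1) 2 a"

lemma fps_sqrt_unique:
  fixes a s :: "'b::field_char_0 fps"
  assumes "fps_nth a 0 = 1"
  shows "s\<^sup>2 = a \<and> fps_nth s 0 = 1 \<longleftrightarrow> s = fps_sqrt a"
  using radical_unique[of "\<lambda>_ _. 1" 1 a s] power_radical[of a "\<lambda>_ _. 1" 1] assms
  by (auto simp: fps_sqrt_def numeral_2_eq_2)

definition Phi :: "'b::field_char_0 fps \<Rightarrow> 'b fps" where
  "Phi u = u + fps_X / (1 - u)"

definition Psi :: "'b::field_char_0 fps \<Rightarrow> 'b fps" where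
  "Psi v = (1 + v - fps_sqrt ((1 - v)\<^sup>2 + 4 * fps_X)) / 2"

end

theory Submission
  imports Defs "HOL-Library.Disjoint_Sets"
begin

text \<open>
  Substituting truth values for the variables turns a pair (bracketing, valuation) into a binary
  tree whose leaves carry indices of chain elements, and the generating functions of sets of such
  trees turn disjoint unions into sums and formation of implications into products. An implication
  takes the value \<open>v j\<close>, with \<open>j < m - 1\<close>, exactly if its right side has value \<open>v j\<close> and its left
  side has a larger value, so \<open>G\<^sub>j = x + H\<^sub>j\<^sub>+\<^sub>1 G\<^sub>j\<close>, that is \<open>H\<^sub>j = \<Phi>(H\<^sub>j\<^sub>+\<^sub>1)\<close>; likewise
  \<open>G = m x + G\<^sup>2\<close>. For series with zero constant term, \<open>\<Phi>(u) = w\<close> means \<open>(w - u)(1 - u) = x\<close>,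
  and completing the square gives \<open>u = \<Psi>(w)\<close>.
\<close>

subsection \<open>The maps \<open>\<Phi>\<close> and \<open>\<Psi>\<close>\<close>

text \<open>In characteristic 0 the series \<open>2\<close> is a unit, so dividing by it is exact.
  This clears the denominator in \<open>Psi\<close> and in the closed form of the total
  series.\<close>

lemma fps_divide_2_eq_iff: "a / 2 = u \<longleftrightarrow> a = 2 * u" for a u :: "'b::field_char_0 fps"
proof -
  have "(2 :: 'b fps) dvd 1"
    by (simp add: fps_is_unit_iff fps_numeral_nth_0)
  then have "(2 :: 'b fps) dvd a"
    by (rule unit_imp_dvd)
  then show ?thesis
    by auto
qed

lemma Phi_eq_iff:
  fixes u w :: "'b::field_char_0 fps"
  assumes "u \<in> fps_zero_const"
  shows "Phi u = w \<longleftrightarrow> (w - u) * (1 - u) = fps_X"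
proof -
  have unit: "1 - u dvd 1"
    using assms by (simp add: fps_zero_const_def fps_is_unit_iff)
  then have "1 - u \<noteq> 0" and dvd: "1 - u dvd fps_X"
    by (auto intro: unit_imp_dvd)
  have "Phi u = w \<longleftrightarrow> fps_X / (1 - u) = w - u"
    by (auto simp: Phi_def algebra_simps)
  also have "\<dots> \<longleftrightarrow> fps_X = (w - u) * (1 - u)"
    using dvd \<open>1 - u \<noteq> 0\<close> by (simp add: dvd_div_eq_mult)
  finally show ?thesis
    by auto
qed

text \<open>This one equivalence yields that \<open>Psi\<close> preserves zero constant terms and
  that it inverts \<open>Phi\<close> on both sides.\<close>

lemma Psi_eq_iff:
  fixes u w :: "'b::field_char_0 fps"
  assumes "w \<in> fps_zero_const"
  shows "Psi w = u \<longleftrightarrow> u \<in> fps_zero_const \<and> Phi u = w"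
proof -
  have "Psi w = u \<longleftrightarrow> 1 + w - 2 * u = fps_sqrt ((1 - w)\<^sup>2 + 4 * fps_X)"
    unfolding Psi_def fps_divide_2_eq_iff by (auto simp only: diff_eq_eq add.commute)
  also have "\<dots> \<longleftrightarrow> (1 + w - 2 * u)\<^sup>2 = (1 - w)\<^sup>2 + 4 * fps_X \<and> fps_nth (1 + w - 2 * u) 0 = 1"
    using assms by (subst fps_sqrt_unique) (auto simp: fps_zero_const_def power2_eq_square)
  \<comment> \<open>The constant term is 1 minus twice that of \<open>u\<close>: choosing the branch
    of the square root amounts to requiring zero constant term of \<open>u\<close>.\<close>
  also have "fps_nth (1 + w - 2 * u) 0 = 1 \<longleftrightarrow> u \<in> fps_zero_const"
    using assms by (auto simp: fps_zero_const_def fps_numeral_nth_0)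
  \<comment> \<open>The difference of the two squares factors as
    \<open>(2 * w - 2 * u) * (2 - 2 * u)\<close>.\<close>
  also have "(1 + w - 2 * u)\<^sup>2 = (1 - w)\<^sup>2 + 4 * fps_X \<longleftrightarrow> 4 * ((w - u) * (1 - u)) = 4 * fps_X"
    by (auto simp: power2_eq_square algebra_simps)
  also have "\<dots> \<longleftrightarrow> (w - u) * (1 - u) = fps_X"
    by (subst mult_cancel_left) simp
  finally show ?thesis
    using Phi_eq_iff by blast
qed

lemma Phi_in_fps_zero_const:
  "u \<in> fps_zero_const \<Longrightarrow> Phi u \<in> fps_zero_const" for u :: "'b::field_char_0 fps"
  by (auto simp: Phi_def fps_zero_const_def fps_divide_unit)

lemma Psi_in_fps_zero_const:
  "w \<in> fps_zero_const \<Longrightarrow> Psi w \<in> fps_zero_const" for w :: "'b::field_char_0 fps"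
  using Psi_eq_iff by blast

lemma Phi_Psi: "w \<in> fps_zero_const \<Longrightarrow> Phi (Psi w) = w" for w :: "'b::field_char_0 fps"
  using Psi_eq_iff by blast

lemma Psi_Phi: "u \<in> fps_zero_const \<Longrightarrow> Psi (Phi u) = u" for u :: "'b::field_char_0 fps"
  using Psi_eq_iff Phi_in_fps_zero_const by blast

lemma bij_betw_Phi:
  "bij_betw Phi (fps_zero_const :: 'b::field_char_0 fps set) fps_zero_const"
  by (rule bij_betwI[of _ _ _ Psi])
    (auto simp: Phi_in_fps_zero_const Psi_in_fps_zero_const Phi_Psi Psi_Phi)

lemma inv_into_Phi:
  assumes "w \<in> (fps_zero_const :: 'b::field_char_0 fps set)"
  shows "inv_into fps_zero_const Phi w = Psi w"
  using assms bij_betw_Phi[where 'b = 'b]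
  by (intro inv_into_f_eq) (auto simp: bij_betw_def Psi_in_fps_zero_const Phi_Psi)

text \<open>Completing the square: \<open>1 - 2 * g\<close> is a root of the discriminant, and zero
  constant term of \<open>g\<close> makes it the root with constant term 1.\<close>

lemma catalan_fps_eq:
  fixes g :: "'b::field_char_0 fps"
  assumes "g = of_nat m * fps_X + g * g" and "g \<in> fps_zero_const"
  shows "g = (1 - fps_sqrt (1 - 4 * of_nat m * fps_X)) / 2"
proof -
  have "(1 - 2 * g)\<^sup>2 = 1 - 4 * (g - g * g)"
    by (simp add: power2_eq_square algebra_simps)
  also have "g - g * g = of_nat m * fps_X"
    using assms(1) by (simp add: algebra_simps)
  finally have "(1 - 2 * g)\<^sup>2 = 1 - 4 * of_nat m * fps_X"
    by (simp add: mult.assoc)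
  moreover have "fps_nth (1 - 2 * g) 0 = 1"
    using assms(2) by (simp add: fps_zero_const_def)
  ultimately have "1 - 2 * g = fps_sqrt (1 - 4 * of_nat m * fps_X)"
    by (subst fps_sqrt_unique[symmetric]) auto
  then have "(1 - fps_sqrt (1 - 4 * of_nat m * fps_X)) / 2 = g"
    by (subst fps_divide_2_eq_iff) (simp add: algebra_simps)
  then show ?thesis
    by simp
qed

subsection \<open>Generating functions of sets of formulas\<close>

text \<open>A leaf \<open>Var i\<close> stands for the chain element \<open>v i\<close>, so such
  trees are evaluated with \<open>v\<close> itself as the valuation.\<close>

definition formulas_over :: "nat \<Rightarrow> formula set" where
  "formulas_over m = {\<chi>. set (leaves \<chi>) \<subseteq> {..<m}}"

lemma Var_in_formulas_over: "Var i \<in> formulas_over m \<longleftrightarrow> i < m"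
  by (simp add: formulas_over_def)

lemma Imp_in_formulas_over:
  "Imp a b \<in> formulas_over m \<longleftrightarrow> a \<in> formulas_over m \<and> b \<in> formulas_over m"
  by (simp add: formulas_over_def)

text \<open>Since \<open>card\<close> is 0 on infinite sets, this counts faithfully only if each
  leaf number occurs finitely often; subsets of \<open>formulas_over m\<close> ensure that.\<close>

definition gf :: "formula set \<Rightarrow> 'b::field_char_0 fps" where
  "gf P = Abs_fps (\<lambda>n. of_nat (card {\<chi>\<in>P. length (leaves \<chi>) = n}))"

lemma leaves_ne_Nil: "leaves \<chi> \<noteq> []"
  by (induction \<chi>) auto

text \<open>Both sides of an implication have fewer leaves than the whole, so strong induction on
  the number of leaves applies.\<close>

lemma finite_formulas_over_length: "finite {\<chi>\<in>formulas_over m. length (leaves \<chi>) = n}"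
proof (induction n rule: less_induct)
  case (less n)
  let ?L = "\<lambda>n. {\<chi>\<in>formulas_over m. length (leaves \<chi>) = n}"
  have "?L n \<subseteq> Var ` {..<m} \<union> (\<Union>k<n. \<Union>l<n. case_prod Imp ` (?L k \<times> ?L l))"
  proof
    fix \<chi> assume "\<chi> \<in> ?L n"
    then show "\<chi> \<in> Var ` {..<m} \<union> (\<Union>k<n. \<Union>l<n. case_prod Imp ` (?L k \<times> ?L l))"
      proof (cases \<chi>)
      case (Imp a b)
      then have "\<chi> \<in> case_prod Imp ` (?L (length (leaves a)) \<times> ?L (length (leaves b)))"
        using \<open>\<chi> \<in> ?L n\<close> by (auto simp: Imp_in_formulas_over)
      moreover have "length (leaves a) < n" "length (leaves b) < n"
        using Imp \<open>\<chi> \<in> ?L n\<close> by (auto simp: leaves_ne_Nil)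
      ultimately show ?thesis
        by blast
    qed (auto simp: Var_in_formulas_over)
  qed
  moreover have "finite (Var ` {..<m} \<union> (\<Union>k<n. \<Union>l<n. case_prod Imp ` (?L k \<times> ?L l)))"
    using less.IH by auto
  ultimately show ?case
    by (rule finite_subset)
qed

lemma finite_length:
  assumes "P \<subseteq> formulas_over m"
  shows "finite {\<chi>\<in>P. length (leaves \<chi>) = n}"
  by (rule finite_subset[OF _ finite_formulas_over_length[of m n]]) (use assms in auto)

lemma gf_in_fps_zero_const: "gf P \<in> fps_zero_const"
  by (simp add: gf_def fps_zero_const_def leaves_ne_Nil)

lemma gf_empty: "gf {} = 0"
  by (rule fps_ext) (simp add: gf_def)

lemma gf_Un:
  assumes "P \<subseteq> formulas_over m" "Q \<subseteq> formulas_over m" "P \<inter> Q = {}"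
  shows "gf (P \<union> Q) = gf P + gf Q"
proof (rule fps_ext)
  fix n
  have "{\<chi>\<in>P \<union> Q. length (leaves \<chi>) = n} =
      {\<chi>\<in>P. length (leaves \<chi>) = n} \<union> {\<chi>\<in>Q. length (leaves \<chi>) = n}"
    by auto
  moreover have "card \<dots> =
      card {\<chi>\<in>P. length (leaves \<chi>) = n} + card {\<chi>\<in>Q. length (leaves \<chi>) = n}"
    using assms by (intro card_Un_disjoint finite_length) auto
  ultimately show "fps_nth (gf (P \<union> Q)) n = fps_nth (gf P + gf Q) n"
    by (simp add: gf_def)
qed

lemma gf_UN:
  assumes "finite I" "\<And>i. i \<in> I \<Longrightarrow> P i \<subseteq> formulas_over m" "disjoint_family_on P I"
  shows "(gf (\<Union>i\<in>I. P i) :: 'b::field_char_0 fps) = (\<Sum>i\<in>I. gf (P i))"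
  using assms
proof (induction I rule: finite_induct)
  case (insert i I)
  then have "(gf (\<Union>i\<in>insert i I. P i) :: 'b fps) = gf (P i) + gf (\<Union>i\<in>I. P i)"
    unfolding UN_insert by (intro gf_Un[of _ m]) (auto simp: disjoint_family_on_def)
  then show ?case
    using insert by (auto simp: disjoint_family_on_def)
qed (simp add: gf_empty)

lemma gf_Var:
  assumes "finite A"
  shows "gf (Var ` A) = of_nat (card A) * fps_X"
proof (rule fps_ext)
  fix n
  have "{\<chi>\<in>Var ` A. length (leaves \<chi>) = n} = (if n = 1 then Var ` A else {})"
    by auto
  then show "fps_nth (gf (Var ` A)) n = fps_nth (of_nat (card A) * fps_X) n"
    by (auto simp: gf_def card_image inj_on_def fps_of_nat[symmetric])
qed

text \<open>Numbers of leaves add up under \<open>Imp\<close>, and \<open>Imp\<close> is injective;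
  sorting by the number of leaves on the left gives the Cauchy product.\<close>

lemma gf_Imp:
  assumes "P \<subseteq> formulas_over m" "Q \<subseteq> formulas_over m"
  shows "gf (case_prod Imp ` (P \<times> Q)) = gf P * gf Q"
proof (rule fps_ext)
  fix n
  let ?L = "\<lambda>P n. {\<chi>\<in>P. length (leaves \<chi>) = n}"
  have inj: "inj_on (case_prod Imp) A" for A
    by (auto simp: inj_on_def)
  have "?L (case_prod Imp ` (P \<times> Q)) n = (\<Union>k\<in>{0..n}. case_prod Imp ` (?L P k \<times> ?L Q (n - k)))"
    by (auto simp: image_iff)
  also have "card \<dots> = (\<Sum>k\<in>{0..n}. card (case_prod Imp ` (?L P k \<times> ?L Q (n - k))))"
    using assms by (intro card_UN_disjoint) (auto intro!: finite_imageI finite_length)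
  also have "\<dots> = (\<Sum>k=0..n. card (?L P k) * card (?L Q (n - k)))"
    by (simp add: card_image[OF inj] card_cartesian_product)
  finally show "fps_nth (gf (case_prod Imp ` (P \<times> Q))) n = fps_nth (gf P * gf Q) n"
    by (simp add: gf_def fps_mult_nth)
qed

lemma gf_formulas_over:
  "(gf (formulas_over m) :: 'b::field_char_0 fps) =
    of_nat m * fps_X + gf (formulas_over m) * gf (formulas_over m)"
proof -
  have "formulas_over m =
      Var ` {..<m} \<union> case_prod Imp ` (formulas_over m \<times> formulas_over m)" (is "_ = ?R")
  proof (rule set_eqI)
    show "\<chi> \<in> formulas_over m \<longleftrightarrow> \<chi> \<in> ?R" for \<chi>
      by (cases \<chi>) (auto simp: Var_in_formulas_over Imp_in_formulas_over)
  qed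
  then have "(gf (formulas_over m) :: 'b fps) = gf ?R"
    by (rule arg_cong)
  also have "\<dots> = gf (Var ` {..<m}) + gf (case_prod Imp ` (formulas_over m \<times> formulas_over m))"
    by (rule gf_Un[of _ m]) (auto simp: Var_in_formulas_over Imp_in_formulas_over)
  finally show ?thesis
    by (simp add: gf_Var gf_Imp[of _ m])
qed

subsection \<open>Substituting truth values into bracketings\<close>

primrec rename :: "(nat \<Rightarrow> nat) \<Rightarrow> formula \<Rightarrow> formula" where
  "rename f (Var i) = Var (f i)"
| "rename f (Imp a b) = Imp (rename f a) (rename f b)"

lemma leaves_rename: "leaves (rename f \<phi>) = map f (leaves \<phi>)"
  by (induction \<phi>) auto

lemma eval_formula_rename: "eval_formula \<rho> (rename f \<phi>) = eval_formula (\<rho> \<circ> f) \<phi>"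
  by (induction \<phi>) auto

lemma eval_formula_cong:
  "(\<And>i. i \<in> set (leaves \<phi>) \<Longrightarrow> \<rho> i = \<sigma> i) \<Longrightarrow> eval_formula \<rho> \<phi> = eval_formula \<sigma> \<phi>"
  by (induction \<phi>) auto

text \<open>Renaming keeps the shape, and shape and leaf word determine a formula. Two functions
  \<open>f\<close> and \<open>g\<close> are allowed because the valuations compared later need not
  agree beforehand.\<close>

lemma rename_eq_imp_eq:
  "rename f \<phi> = rename g \<psi> \<Longrightarrow> leaves \<phi> = leaves \<psi> \<Longrightarrow> \<phi> = \<psi>"
proof (induction \<phi> arbitrary: \<psi>)
  case (Var i)
  then show ?case
    by (cases \<psi>) auto
next
  case (Imp a b)
  then obtain c d where \<psi>: "\<psi> = Imp c d" and eq: "rename f a = rename g c" "rename f b = rename g d"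
    by (cases \<psi>) auto
  \<comment> \<open>Equal lengths force the two concatenated leaf words to split at the same
    place.\<close>
  have "length (leaves a) = length (leaves c)"
    using arg_cong[OF eq(1), of "\<lambda>\<chi>. length (leaves \<chi>)"] by (simp add: leaves_rename)
  then show ?case
    using Imp eq \<psi> by auto
qed

text \<open>Keep the shape of \<open>\<chi>\<close> and write \<open>xs\<close> on its leaves. This
  provides the bracketing needed for surjectivity below.\<close>

lemma ex_rename_eq: "map f xs = leaves \<chi> \<Longrightarrow> \<exists>\<phi>. leaves \<phi> = xs \<and> rename f \<phi> = \<chi>"
proof (induction \<chi> arbitrary: xs)
  case (Var i)
  then obtain j where "xs = [j]" "f j = i"
    by auto
  then have "leaves (Var j) = xs \<and> rename f (Var j) = Var i"
    by simp
  then show ?case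
    by blast
next
  case (Imp a b)
  then obtain ys zs where xs: "xs = ys @ zs" "map f ys = leaves a" "map f zs = leaves b"
    by (auto simp: map_eq_append_conv)
  then obtain \<phi> \<psi> where "leaves \<phi> = ys" "rename f \<phi> = a" "leaves \<psi> = zs" "rename f \<psi> = b"
    using Imp.IH by blast
  then have "leaves (Imp \<phi> \<psi>) = xs \<and> rename f (Imp \<phi> \<psi>) = Imp a b"
    using xs by simp
  then show ?case
    by blast
qed

text \<open>The bracketing supplies the shape and the valuation the leaf labels. As the variables of
  a bracketing are distinct and occur in order, both can be read off the labelled tree.\<close>

lemma bij_betw_rename_bracketings:
  fixes v :: "nat \<Rightarrow> 'a::{linorder,zero,one}"
  assumes "inj_on v {..<m}"
  shows "bij_betw (\<lambda>(\<phi>, \<rho>). rename (inv_into {..<m} v \<circ> \<rho>) \<phi>)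
    {(\<phi>, \<rho>). \<phi> \<in> bracketings n \<and> \<rho> \<in> valuations m v n \<and> eval_formula \<rho> \<phi> = c}
    {\<chi> \<in> formulas_over m. eval_formula v \<chi> = c \<and> length (leaves \<chi>) = n}"
    (is "bij_betw ?F ?A ?B")
proof -
  let ?w = "inv_into {..<m} v"
  have range: "\<rho> i \<in> v ` {..<m}" if "\<rho> \<in> valuations m v n" "i \<in> {1..n}" for \<rho> i
    using that by (auto simp: valuations_def)
  \<comment> \<open>On chain elements \<open>v\<close> undoes the passage to indices, so
    substitution preserves the truth value.\<close>
  have eval: "eval_formula v (rename (?w \<circ> \<rho>) \<phi>) = eval_formula \<rho> \<phi>"
    if "\<phi> \<in> bracketings n" "\<rho> \<in> valuations m v n" for \<phi> \<rho>
    unfolding eval_formula_rename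
  proof (rule eval_formula_cong)
    fix i assume "i \<in> set (leaves \<phi>)"
    then have "i \<in> {1..n}"
      using that by (auto simp: bracketings_def)
    then show "(v \<circ> (?w \<circ> \<rho>)) i = \<rho> i"
      using range[OF that(2)] by (simp add: f_inv_into_f)
  qed
  have inj: "inj_on ?F ?A"
  proof (rule inj_onI, clarify)
    fix \<phi> \<rho> \<psi> \<sigma>
    assume mem: "\<phi> \<in> bracketings n" "\<rho> \<in> valuations m v n" "\<psi> \<in> bracketings n" "\<sigma> \<in> valuations m v n"
      and eq: "rename (?w \<circ> \<rho>) \<phi> = rename (?w \<circ> \<sigma>) \<psi>"
    have lv: "leaves \<phi> = [1..<Suc n]" "leaves \<psi> = [1..<Suc n]"
      using mem by (auto simp: bracketings_def)
    have "map (?w \<circ> \<rho>) [1..<Suc n] = map (?w \<circ> \<sigma>) [1..<Suc n]"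
      using arg_cong[OF eq, of leaves] by (simp add: leaves_rename lv del: upt_Suc)
    then have w: "?w (\<rho> i) = ?w (\<sigma> i)" if "i \<in> {1..n}" for i
      using that by (auto simp del: upt_Suc)
    have "\<rho> i = \<sigma> i" if "i \<in> {1..n}" for i
      using inv_into_injective[OF w[OF that]] range that mem by blast
    \<comment> \<open>Valuations are extensional, so agreement on \<open>{1..n}\<close>
      suffices.\<close>
    then have "\<rho> = \<sigma>"
      using mem by (intro PiE_ext[of \<rho> "{1..n}" "\<lambda>_. v ` {..<m}" \<sigma>]) (auto simp: valuations_def)
    then show "\<phi> = \<psi> \<and> \<rho> = \<sigma>"
      using rename_eq_imp_eq[OF eq] lv by simp
  qed
  have "?F ` ?A \<subseteq> ?B"
  proof clarify
    fix \<phi> \<rho>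
    assume mem: "\<phi> \<in> bracketings n" "\<rho> \<in> valuations m v n" and c: "c = eval_formula \<rho> \<phi>"
    have lv: "leaves \<phi> = [1..<Suc n]"
      using mem by (auto simp: bracketings_def)
    have "?w (\<rho> i) < m" if "i \<in> {1..n}" for i
      using inv_into_into[OF range[OF mem(2) that]] by simp
    then have "rename (?w \<circ> \<rho>) \<phi> \<in> formulas_over m"
      by (auto simp: formulas_over_def leaves_rename lv simp del: upt_Suc)
    then show "rename (?w \<circ> \<rho>) \<phi> \<in> formulas_over m \<and>
        eval_formula v (rename (?w \<circ> \<rho>) \<phi>) = eval_formula \<rho> \<phi> \<and>
        length (leaves (rename (?w \<circ> \<rho>) \<phi>)) = n"
      using eval mem by (simp add: leaves_rename lv)
  qed
  moreover have "?B \<subseteq> ?F ` ?A"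
  proof
    fix \<chi> assume "\<chi> \<in> ?B"
    then have \<chi>: "set (leaves \<chi>) \<subseteq> {..<m}" "length (leaves \<chi>) = n" "eval_formula v \<chi> = c"
      by (auto simp: formulas_over_def)
    \<comment> \<open>Variables are numbered from 1 and list positions from 0, hence
      \<open>i - 1\<close>; \<open>restrict\<close> makes the valuation extensional.\<close>
    define \<rho> where "\<rho> = restrict (\<lambda>i. v (leaves \<chi> ! (i - 1))) {1..n}"
    have less: "leaves \<chi> ! i < m" if "i < n" for i
      using \<chi> that nth_mem by blast
    then have \<rho>: "\<rho> \<in> valuations m v n"
      by (auto simp: \<rho>_def valuations_def)
    have "map (?w \<circ> \<rho>) [1..<Suc n] = leaves \<chi>"
      using less \<chi>(2) assms by (intro nth_equalityI) (auto simp: \<rho>_def inv_into_f_f simp del: upt_Suc)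
    then obtain \<phi> where \<phi>: "leaves \<phi> = [1..<Suc n]" "rename (?w \<circ> \<rho>) \<phi> = \<chi>"
      using ex_rename_eq by blast
    then have "(\<phi>, \<rho>) \<in> ?A"
      using \<rho> \<chi>(3) eval[of \<phi> \<rho>] by (auto simp: bracketings_def)
    then show "\<chi> \<in> ?F ` ?A"
      using \<phi>(2) by force
  qed
  ultimately show ?thesis
    using inj by (auto simp: bij_betw_def)
qed

subsection \<open>The functional equations\<close>

definition formulas_with_value :: "nat \<Rightarrow> (nat \<Rightarrow> 'a::{linorder,zero,one}) \<Rightarrow> nat \<Rightarrow> formula set" where
  "formulas_with_value m v j = {\<chi> \<in> formulas_over m. eval_formula v \<chi> = v j}"

lemma formulas_with_value_subset: "formulas_with_value m v j \<subseteq> formulas_over m"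
  by (auto simp: formulas_with_value_def)

lemma value_fps_eq_gf:
  assumes "inj_on v {..<m}"
  shows "value_fps m v j = gf (formulas_with_value m v j)"
proof (rule fps_ext)
  fix n
  have "count_value m v j n = card {\<chi> \<in> formulas_with_value m v j. length (leaves \<chi>) = n}"
    using bij_betw_same_card[OF bij_betw_rename_bracketings[OF assms, of n "v j"]]
    by (simp add: count_value_def formulas_with_value_def conj_assoc)
  \<comment> \<open>Needed for \<open>n = 0\<close>, where \<open>value_fps\<close> is 0 by
    definition.\<close>
  moreover have "fps_nth (gf (formulas_with_value m v j)) 0 = 0"
    using gf_in_fps_zero_const by (simp add: fps_zero_const_def)
  ultimately show "fps_nth (value_fps m v j) n = fps_nth (gf (formulas_with_value m v j)) n"
    by (cases "n = 0") (auto simp: value_fps_def gf_def)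
qed

context
  fixes m :: nat and v :: "nat \<Rightarrow> 'a::{linorder,zero,one}"
  assumes m: "m \<ge> 2" and chain: "is_chain m v"
begin

lemma chain_less_iff: "i < m \<Longrightarrow> j < m \<Longrightarrow> v i < v j \<longleftrightarrow> i < j"
  using chain by (auto simp: is_chain_def strict_mono_on_less)

lemma chain_inj: "inj_on v {..<m}"
  using chain by (auto simp: is_chain_def intro: strict_mono_on_imp_inj_on)

lemma chain_top: "v (m - 1) = 1"
  using chain by (simp add: is_chain_def)

text \<open>A Goedel implication returns 1, which is \<open>v (m - 1)\<close>, or its right
  argument.\<close>

lemma eval_formula_in_chain: "\<chi> \<in> formulas_over m \<Longrightarrow> eval_formula v \<chi> \<in> v ` {..<m}"
proof (induction \<chi>)
  case (Imp a b)
  have "1 \<in> v ` {..<m}"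
    using m chain_top by (intro image_eqI[of _ _ "m - 1"]) auto
  then show ?case
    using Imp by (auto simp: Imp_in_formulas_over goedel_imp_def)
qed (simp add: Var_in_formulas_over)

lemma disjoint_formulas_with_value:
  "I \<subseteq> {..<m} \<Longrightarrow> disjoint_family_on (formulas_with_value m v) I"
  using chain_inj by (fastforce simp: disjoint_family_on_def formulas_with_value_def inj_on_def)

lemma gf_formulas_with_value:
  "I \<subseteq> {..<m} \<Longrightarrow> gf (\<Union>i\<in>I. formulas_with_value m v i) = (\<Sum>i\<in>I. value_fps m v i)"
  by (subst gf_UN[where m = m])
    (auto simp: value_fps_eq_gf[OF chain_inj] disjoint_formulas_with_value
      intro: finite_subset dest: formulas_with_value_subset[THEN subsetD])

text \<open>Every tree has exactly one value in the chain, so the sum over all values counts all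
  trees, for which the Catalan-type equation is available.\<close>

lemma total_fps_eq_gf: "total_fps m v = gf (formulas_over m)"
proof -
  have "formulas_over m = (\<Union>i<m. formulas_with_value m v i)"
    using eval_formula_in_chain by (auto simp: formulas_with_value_def)
  then show ?thesis
    by (simp add: total_fps_eq_sum gf_formulas_with_value)
qed

lemma tail_fps_eq_gf: "tail_fps m v k = gf (\<Union>i\<in>{k..m - 1}. formulas_with_value m v i)"
  using m by (subst gf_formulas_with_value) (auto simp: tail_fps_def)

lemma tail_fps_0: "tail_fps m v 0 = total_fps m v"
  using m by (auto simp: tail_fps_def total_fps_eq_sum intro: sum.cong)

lemma formulas_with_value_rec:
  assumes "k < m - 1"
  shows "formulas_with_value m v k =
    Var ` {k} \<union> case_prod Imp `
      ((\<Union>i\<in>{Suc k..m - 1}. formulas_with_value m v i) \<times> formulas_with_value m v k)" (is "_ = ?R")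
proof (rule set_eqI)
  fix \<chi>
  show "\<chi> \<in> formulas_with_value m v k \<longleftrightarrow> \<chi> \<in> ?R"
  proof (cases \<chi>)
    case (Var i)
    then show ?thesis
      using assms inj_onD[OF chain_inj, of i k]
      by (auto simp: formulas_with_value_def Var_in_formulas_over)
  next
    case (Imp a b)
    \<comment> \<open>Excludes the case of \<open>goedel_imp\<close> with result 1; this is where
      \<open>k < m - 1\<close> is essential.\<close>
    have "v k < 1"
      using chain_less_iff[of k "m - 1"] assms chain_top by simp
    then have "goedel_imp (eval_formula v a) (eval_formula v b) = v k \<longleftrightarrow>
        v k < eval_formula v a \<and> eval_formula v b = v k"
      by (auto simp: goedel_imp_def)
    \<comment> \<open>Values of trees lie in the chain, so being larger than \<open>v k\<close>
      means having an index beyond \<open>k\<close>.\<close>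
    moreover have "v k < eval_formula v a \<longleftrightarrow> (\<exists>i\<in>{Suc k..m - 1}. eval_formula v a = v i)"
      if a: "a \<in> formulas_over m"
    proof -
      obtain j where j: "j < m" "eval_formula v a = v j"
        using eval_formula_in_chain[OF a] by auto
      have "v k < v j \<longleftrightarrow> k < j"
        using assms j by (simp add: chain_less_iff)
      moreover have "v j = v i \<longleftrightarrow> i = j" if "i \<in> {Suc k..m - 1}" for i
        using inj_onD[OF chain_inj, of i j] that j assms by auto
      ultimately show ?thesis
        using j by auto
    qed
    ultimately show ?thesis
      using Imp by (auto simp: formulas_with_value_def Imp_in_formulas_over)
  qed
qed

lemma value_fps_rec:
  assumes "k < m - 1"
  shows "(value_fps m v k :: 'b::field_char_0 fps) = fps_X + tail_fps m v (Suc k) * value_fps m v k"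
proof -
  let ?T = "\<Union>i\<in>{Suc k..m - 1}. formulas_with_value m v i"
  have T: "?T \<subseteq> formulas_over m"
    using formulas_with_value_subset by blast
  have "(value_fps m v k :: 'b fps) = gf (Var ` {k} \<union> case_prod Imp ` (?T \<times> formulas_with_value m v k))"
    using formulas_with_value_rec[OF assms] by (simp add: value_fps_eq_gf[OF chain_inj])
  also have "\<dots> = gf (Var ` {k}) + gf (case_prod Imp ` (?T \<times> formulas_with_value m v k))"
    using assms by (intro gf_Un[of _ m])
      (auto simp: Var_in_formulas_over Imp_in_formulas_over formulas_with_value_def)
  also have "\<dots> = fps_X + gf ?T * gf (formulas_with_value m v k)"
    unfolding gf_Imp[OF T formulas_with_value_subset] by (simp add: gf_Var[of "{k}", simplified])
  finally show ?thesis
    by (simp add: tail_fps_eq_gf value_fps_eq_gf[OF chain_inj])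
qed

lemma tail_fps_split:
  "k < m - 1 \<Longrightarrow> (tail_fps m v k :: 'b::field_char_0 fps) = value_fps m v k + tail_fps m v (Suc k)"
  by (simp add: tail_fps_def sum.atLeast_Suc_atMost)

lemma tail_fps_in_fps_zero_const: "tail_fps m v k \<in> fps_zero_const"
  by (simp add: tail_fps_eq_gf gf_in_fps_zero_const)

text \<open>Writing \<open>value_fps m v k\<close> as a difference of consecutive tails turns its
  linear recursion into the product form of \<open>Phi_eq_iff\<close>.\<close>

lemma tail_fps_eq_Phi:
  assumes "k < m - 1"
  shows "(tail_fps m v k :: 'b::field_char_0 fps) = Phi (tail_fps m v (Suc k))"
proof -
  have "((tail_fps m v k :: 'b fps) - tail_fps m v (Suc k)) * (1 - tail_fps m v (Suc k)) = fps_X"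
    using value_fps_rec[OF assms, where 'b = 'b]
    by (simp add: tail_fps_split[OF assms] algebra_simps)
  then show ?thesis
    using Phi_eq_iff[OF tail_fps_in_fps_zero_const] by metis
qed

text \<open>Each application of \<open>Psi\<close> removes the lowest remaining value from the tail,
  starting from the total series.\<close>

lemma tail_fps_eq_Psi_iterate:
  "k \<le> m - 1 \<Longrightarrow> (tail_fps m v k :: 'b::field_char_0 fps) = (Psi ^^ k) (total_fps m v)"
proof (induction k)
  case (Suc k)
  then have "Psi (tail_fps m v k) = (tail_fps m v (Suc k) :: 'b fps)"
    using Psi_Phi[OF tail_fps_in_fps_zero_const[of "Suc k"], where 'b = 'b] by (simp add: tail_fps_eq_Phi)
  then show ?case
    using Suc by simp
qed (simp add: tail_fps_0)

end

theorem proposition6: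
  fixes m :: nat
    and v :: "nat \<Rightarrow> 'a::{linorder,zero,one}"
  assumes "m \<ge> 2"
    and "is_chain m v"
  shows "bij_betw Phi (fps_zero_const :: 'b::field_char_0 fps set) fps_zero_const \<and>
    (\<forall>w\<in>(fps_zero_const :: 'b fps set).
       Psi w \<in> fps_zero_const \<and>
       inv_into fps_zero_const Phi w = Psi w \<and>
       Phi (Psi w) = w) \<and>
    (\<forall>u\<in>(fps_zero_const :: 'b fps set). Psi (Phi u) = u) \<and>
    (value_fps m v (m - 1) :: 'b fps) = (Psi ^^ (m - 1)) (total_fps m v) \<and>
    (total_fps m v :: 'b fps) = (1 - fps_sqrt (1 - 4 * of_nat m * fps_X)) / 2 \<and>
    (tail_fps m v (m - 1) :: 'b fps) = value_fps m v (m - 1) \<and>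
    (\<forall>k\<le>m - 2. (tail_fps m v k :: 'b fps) = Phi (tail_fps m v (k + 1))) \<and>
    (\<forall>k\<le>m - 2. (value_fps m v k :: 'b fps) = tail_fps m v k - tail_fps m v (k + 1)) \<and>
    (value_fps m v (m - 1) :: 'b fps) = tail_fps m v (m - 1)"
proof -
  note m = \<open>m \<ge> 2\<close> and chain = \<open>is_chain m v\<close>
  have top: "(tail_fps m v (m - 1) :: 'b fps) = value_fps m v (m - 1)"
    by (simp add: tail_fps_def)
  moreover have "(total_fps m v :: 'b fps) = (1 - fps_sqrt (1 - 4 * of_nat m * fps_X)) / 2"
    unfolding total_fps_eq_gf[OF m chain]
    by (intro catalan_fps_eq gf_formulas_over gf_in_fps_zero_const)
  moreover have "(tail_fps m v k :: 'b fps) = Phi (tail_fps m v (k + 1))"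
    and "(value_fps m v k :: 'b fps) = tail_fps m v k - tail_fps m v (k + 1)" if "k \<le> m - 2" for k
  proof -
    \<comment> \<open>Subtraction on naturals truncates, so \<open>m \<ge> 2\<close> is used
      here.\<close>
    have k: "k < m - 1"
      using that m by linarith
    show "(tail_fps m v k :: 'b fps) = Phi (tail_fps m v (k + 1))"
      using tail_fps_eq_Phi[OF m chain k] by simp
    show "(value_fps m v k :: 'b fps) = tail_fps m v k - tail_fps m v (k + 1)"
      using tail_fps_split[OF m chain k, where 'b = 'b] by simp
  qed
  moreover have "(value_fps m v (m - 1) :: 'b fps) = (Psi ^^ (m - 1)) (total_fps m v)"
    using tail_fps_eq_Psi_iterate[OF m chain, of "m - 1", where 'b = 'b] top by simp
  ultimately show ?thesis
    using bij_betw_Phi inv_into_Phi Psi_in_fps_zero_const Phi_Psi Psi_Phi by auto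
qed

end
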